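(* For every integer $k\ge3$ there exist infinitely many (pairwise non-isomorphic) irreducible critically $k$-frustrated signed graphs whose underlying graph is planar.
   Context: A signed graph $(G,\sigma)$ is a finite graph $G$ (loops and multiple edges allowed) with $\sigma:E(G)\to\{+,-\}$. Switching at a vertex $v$ multiplies the signs of all edges at $v$ by $-$. The frustration index $\ell(G,\sigma)$ is the minimum number of negative edges over all signatures obtained from $\sigma$ by switchings. $(G,\sigma)$ is critically $k$-frustrated if $\ell(G,\sigma)=k$ and $\ell(G-e,\sigma)=k-1$ for every edge $e$. A $t$-multiedge $E_{xy}$ is a set of $t$ parallel edges joining distinct vertices $x,y$, all of the same sign. Subdividing at $E_{xy}$: delete $E_{xy}$, add a new vertex $w$, a $t$-multiedge $E_{xw}$ with the sign of $E_{xy}$ and an all-positive $t$-multiedge $E_{wy}$. A subdivision is obtained by a sequence of such operations; a signed graph is irreducible if it is not a proper subdivision of any signed graph. *)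

theory Defs
  imports "HOL-Analysis.Analysis"
begin

datatype sign = Pos | Neg

fun opposite :: "sign \<Rightarrow> sign" where
  "opposite Pos = Neg"
| "opposite Neg = Pos"

text \<open>
  Multigraphs with loops: edges are named objects, and \<open>ends G e\<close> is the set of end vertices of
  the edge \<open>e\<close>, a singleton when \<open>e\<close> is a loop. The values of \<open>ends\<close> and \<open>sgn_of\<close> outside
  \<open>edges G\<close> are irrelevant.
\<close>

record ('v, 'e) sgraph =
  verts :: "'v set"
  edges :: "'e set"
  ends :: "'e \<Rightarrow> 'v set"
  sgn_of :: "'e \<Rightarrow> sign"

definition signed_graph :: "('v, 'e) sgraph \<Rightarrow> bool" where
  "signed_graph G \<longleftrightarrow> finite (verts G) \<and> finite (edges G) \<and>
     (\<forall>e\<in>edges G. \<exists>x\<in>verts G. \<exists>y\<in>verts G. ends G e = {x, y})"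

text \<open>
  Deleting or adding isolated vertices changes neither the frustration index nor criticality, so
  critical signed graphs are taken without them; otherwise adding isolated vertices to one graph
  would already give an infinite family.
\<close>

definition no_isolated_vertices :: "('v, 'e) sgraph \<Rightarrow> bool" where
  "no_isolated_vertices G \<longleftrightarrow> (\<forall>v\<in>verts G. \<exists>e\<in>edges G. v \<in> ends G e)"

definition del_edge :: "('v, 'e) sgraph \<Rightarrow> 'e \<Rightarrow> ('v, 'e) sgraph" where
  "del_edge G e = G\<lparr>edges := edges G - {e}\<rparr>"

definition neg_edges :: "('v, 'e) sgraph \<Rightarrow> 'e set" where
  "neg_edges G = {e \<in> edges G. sgn_of G e = Neg}"

text \<open>
  A loop at \<open>v\<close> meets \<open>v\<close> with both of its ends, so switching at \<open>v\<close> multiplies its sign by \<open>-\<close>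
  twice and leaves it unchanged.
\<close>

definition switch_at :: "'v \<Rightarrow> ('v, 'e) sgraph \<Rightarrow> ('v, 'e) sgraph" where
  "switch_at v G = G\<lparr>sgn_of := \<lambda>e. if v \<in> ends G e \<and> ends G e \<noteq> {v}
                                   then opposite (sgn_of G e) else sgn_of G e\<rparr>"

inductive switching_equiv :: "('v, 'e) sgraph \<Rightarrow> ('v, 'e) sgraph \<Rightarrow> bool" for G where
  refl: "switching_equiv G G"
| switch: "switching_equiv G H \<Longrightarrow> v \<in> verts G \<Longrightarrow> switching_equiv G (switch_at v H)"

definition frustration_index :: "('v, 'e) sgraph \<Rightarrow> nat" where
  "frustration_index G = (LEAST n. \<exists>H. switching_equiv G H \<and> card (neg_edges H) = n)"

definition critically_frustrated :: "nat \<Rightarrow> ('v, 'e) sgraph \<Rightarrow> bool" where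
  "critically_frustrated k G \<longleftrightarrow> frustration_index G = k \<and>
     (\<forall>e\<in>edges G. frustration_index (del_edge G e) + 1 = k)"

definition multiedge :: "('v, 'e) sgraph \<Rightarrow> 'v \<Rightarrow> 'v \<Rightarrow> sign \<Rightarrow> 'e set \<Rightarrow> bool" where
  "multiedge G x y s M \<longleftrightarrow> x \<in> verts G \<and> y \<in> verts G \<and> x \<noteq> y \<and> M \<noteq> {} \<and> M \<subseteq> edges G \<and>
     (\<forall>e\<in>M. ends G e = {x, y} \<and> sgn_of G e = s)"

text \<open>
  \<open>subdivides_to H G\<close>: subdividing \<open>H\<close> at one multiedge \<open>M\<close> gives \<open>G\<close>; \<open>A\<close> and \<open>B\<close> are the new
  multiedges joining the new vertex \<open>w\<close> to \<open>x\<close> and \<open>y\<close>. The names of \<open>w\<close> and of the new edges are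
  arbitrary fresh ones, which makes the relation invariant under isomorphism when the types of
  vertices and edges are infinite.
\<close>

definition subdivides_to :: "('v, 'e) sgraph \<Rightarrow> ('v, 'e) sgraph \<Rightarrow> bool" where
  "subdivides_to H G \<longleftrightarrow> signed_graph H \<and> signed_graph G \<and>
     (\<exists>x y s M w A B.
        multiedge H x y s M \<and> w \<notin> verts H \<and>
        A \<inter> edges H = {} \<and> B \<inter> edges H = {} \<and> A \<inter> B = {} \<and>
        card A = card M \<and> card B = card M \<and>
        verts G = insert w (verts H) \<and> edges G = (edges H - M) \<union> A \<union> B \<and>
        (\<forall>e\<in>edges H - M. ends G e = ends H e \<and> sgn_of G e = sgn_of H e) \<and>
        multiedge G x w s A \<and> multiedge G w y Pos B)"

definition proper_subdivision :: "('v, 'e) sgraph \<Rightarrow> ('v, 'e) sgraph \<Rightarrow> bool" where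
  "proper_subdivision G H \<longleftrightarrow> subdivides_to\<^sup>+\<^sup>+ H G"

text \<open>
  Signed graphs are considered up to switching. Without this, the sign convention in a subdivision
  (one side keeps the sign, the other one is positive) would make an all-negative path through a
  vertex of degree 2 irreducible, although it is a subdivision after one switching.
\<close>

definition irreducible_sgraph :: "('v, 'e) sgraph \<Rightarrow> bool" where
  "irreducible_sgraph G \<longleftrightarrow> \<not> (\<exists>G' H. switching_equiv G G' \<and> proper_subdivision G' H)"

definition isomorphic_sgraph :: "('v, 'e) sgraph \<Rightarrow> ('w, 'f) sgraph \<Rightarrow> bool" where
  "isomorphic_sgraph G H \<longleftrightarrow>
     (\<exists>f g. bij_betw f (verts G) (verts H) \<and> bij_betw g (edges G) (edges H) \<and>
        (\<forall>e\<in>edges G. ends H (g e) = f ` ends G e \<and> sgn_of H (g e) = sgn_of G e))"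

definition switching_isomorphic :: "('v, 'e) sgraph \<Rightarrow> ('w, 'f) sgraph \<Rightarrow> bool" where
  "switching_isomorphic G H \<longleftrightarrow> (\<exists>G'. switching_equiv G G' \<and> isomorphic_sgraph G' H)"

text \<open>
  The underlying graph can be drawn in the plane: \<open>p\<close> places the vertices and \<open>c e\<close> is the curve
  of the edge \<open>e\<close>, an arc for a non-loop and a simple closed curve for a loop.
\<close>

definition planar :: "('v, 'e) sgraph \<Rightarrow> bool" where
  "planar G \<longleftrightarrow> (\<exists>(p :: 'v \<Rightarrow> complex) (c :: 'e \<Rightarrow> real \<Rightarrow> complex).
     inj_on p (verts G) \<and>
     (\<forall>e\<in>edges G. simple_path (c e) \<and> {pathstart (c e), pathfinish (c e)} = p ` ends G e \<and>
        c e ` {0<..<1} \<inter> p ` verts G = {}) \<and>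
     (\<forall>e\<in>edges G. \<forall>f\<in>edges G. e \<noteq> f \<longrightarrow> c e ` {0<..<1} \<inter> c f ` {0<..<1} = {}))"

end

theory Submission
  imports Defs
begin

text \<open>
  For even \<open>m \<ge> 6\<close> the square of the cycle \<open>C\<^sub>m\<close> is an antiprism, hence planar and 4-regular. Make
  negative the three edges that cross one fixed cut between consecutive vertices of the cycle.
  The edges decompose into three negative cycles: \<open>C\<^sub>m\<close> itself and the two \<open>m/2\<close>-gons of steps
  of length 2. So the frustration index is 3, and since switching moves the cut
  around the cycle, every edge is negative in some signature with three negative edges. Every
  further vertex carrying a single negative loop raises the frustration index by one and
  preserves criticality; it can be drawn far away from the rest. A vertex created by a subdivision
  has no loop and at most two neighbours, and these graphs have no such vertex.
\<close>

subsection \<open>Planar drawings\<close>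

lemma ends_subset_verts: "signed_graph G \<Longrightarrow> e \<in> edges G \<Longrightarrow> ends G e \<subseteq> verts G"
  unfolding signed_graph_def by force

definition planar_drawing :: "('v, 'e) sgraph \<Rightarrow> ('v \<Rightarrow> complex) \<Rightarrow> ('e \<Rightarrow> real \<Rightarrow> complex) \<Rightarrow> bool" where
  "planar_drawing G p c \<longleftrightarrow> inj_on p (verts G) \<and>
     (\<forall>e\<in>edges G. simple_path (c e) \<and> {pathstart (c e), pathfinish (c e)} = p ` ends G e \<and>
        c e ` {0<..<1} \<inter> p ` verts G = {}) \<and>
     (\<forall>e\<in>edges G. \<forall>f\<in>edges G. e \<noteq> f \<longrightarrow> c e ` {0<..<1} \<inter> c f ` {0<..<1} = {})"

lemma planar_iff_planar_drawing: "planar G \<longleftrightarrow> (\<exists>p c. planar_drawing G p c)"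
  by (simp add: planar_def planar_drawing_def)

lemma simple_pathI_interior:
  assumes "path g" and inj: "inj_on g {0<..<1}"
    and "pathstart g \<notin> g ` {0<..<1}" "pathfinish g \<notin> g ` {0<..<1}"
  shows "simple_path g"
proof -
  have endpoint: "g s \<noteq> g t" if "s \<in> {0, 1}" "t \<in> {0<..<1}" for s t
    using assms(3,4) that by (auto simp: pathstart_def pathfinish_def)
  have unit: "{0..1} = {0<..<1} \<union> {0, 1::real}"
    by auto
  have "s = t \<or> s = 0 \<and> t = 1 \<or> s = 1 \<and> t = 0"
    if s: "s \<in> {0..1}" and t: "t \<in> {0..1}" and eq: "g s = g t" for s t
  proof -
    consider (interior) "s \<in> {0<..<1}" "t \<in> {0<..<1}" | (end_left) "s \<in> {0, 1}" "t \<in> {0<..<1}"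
      | (end_right) "s \<in> {0<..<1}" "t \<in> {0, 1}" | (ends) "s \<in> {0, 1}" "t \<in> {0, 1}"
      using s t unfolding unit by blast
    then show ?thesis
    proof cases
      case interior
      then show ?thesis
        using inj_onD[OF inj eq] by blast
    next
      case end_left
      then show ?thesis
        using endpoint[of s t] eq by blast
    next
      case end_right
      then show ?thesis
        using endpoint[of t s] eq by simp
    next
      case ends
      then show ?thesis
        by blast
    qed
  qed
  then show ?thesis
    using assms(1) by (simp add: simple_path_def loop_free_def)
qed

lemma planar_drawingI:
  assumes "signed_graph G" and inj_verts: "inj_on p (verts G)"
    and path: "\<And>e. e \<in> edges G \<Longrightarrow> path (c e)"
    and ends: "\<And>e. e \<in> edges G \<Longrightarrow> {pathstart (c e), pathfinish (c e)} = p ` ends G e"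
    and avoids: "\<And>e v t. e \<in> edges G \<Longrightarrow> v \<in> verts G \<Longrightarrow> t \<in> {0<..<1} \<Longrightarrow> c e t \<noteq> p v"
    and inj: "\<And>e f s t. e \<in> edges G \<Longrightarrow> f \<in> edges G \<Longrightarrow> s \<in> {0<..<1} \<Longrightarrow> t \<in> {0<..<1} \<Longrightarrow>
      c e s = c f t \<Longrightarrow> e = f \<and> s = t"
  shows "planar_drawing G p c"
proof -
  have interior: "c e ` {0<..<1} \<inter> p ` verts G = {}" if "e \<in> edges G" for e
    using avoids[OF that] by blast
  have "simple_path (c e)" if e: "e \<in> edges G" for e
  proof (rule simple_pathI_interior)
    show "path (c e)"
      by (rule path[OF e])
    show "inj_on (c e) {0<..<1}"
      using inj[OF e e] by (intro inj_onI) blast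
    have "{pathstart (c e), pathfinish (c e)} \<subseteq> p ` verts G"
      unfolding ends[OF e] using ends_subset_verts[OF assms(1) e] by (rule image_mono)
    then show "pathstart (c e) \<notin> c e ` {0<..<1}" "pathfinish (c e) \<notin> c e ` {0<..<1}"
      using interior[OF e] by blast+
  qed
  moreover have "c e ` {0<..<1} \<inter> c f ` {0<..<1} = {}"
    if "e \<in> edges G" "f \<in> edges G" "e \<noteq> f" for e f
    using inj[OF that(1,2)] that(3) by blast
  ultimately show ?thesis
    using inj_verts ends interior unfolding planar_drawing_def by simp
qed

definition cylinder_point :: "real \<Rightarrow> real \<Rightarrow> real \<Rightarrow> complex" where
  "cylinder_point L h x = exp (Complex h (2 * pi * x / L))"

lemma cylinder_point_eq_iff:
  assumes "L \<noteq> 0"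
  shows "cylinder_point L h x = cylinder_point L h' x' \<longleftrightarrow> h = h' \<and> (\<exists>n::int. x = x' + of_int n * L)"
proof -
  have "2 * pi * x / L = 2 * pi * x' / L + of_int (2 * n) * pi \<longleftrightarrow> x = x' + of_int n * L" for n :: int
  proof -
    have "2 * pi * x' / L + of_int (2 * n) * pi = 2 * pi * (x' + of_int n * L) / L"
      using assms by (simp add: field_simps)
    then show ?thesis
      using assms by simp
  qed
  then show ?thesis
    unfolding cylinder_point_def exp_eq by (auto simp: complex_eq_iff)
qed

lemma continuous_on_cylinder_point [continuous_intros]:
  assumes "continuous_on A h" "continuous_on A x"
  shows "continuous_on A (\<lambda>t. cylinder_point L (h t) (x t))"
  unfolding cylinder_point_def Complex_eq divide_inverse using assms
  by (auto intro!: continuous_intros)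

subsection \<open>Squares of cycles and their antiprism drawing\<close>

text \<open>
  The edges \<open>2 * i\<close> and \<open>2 * i + 1\<close> go from \<open>i\<close> one and two steps around the cycle; an edge is
  negative iff it passes from \<open>m - 1\<close> to \<open>0\<close>.
\<close>

definition cycle_square :: "nat \<Rightarrow> (nat, nat) sgraph" where
  "cycle_square m = \<lparr>verts = {..<m}, edges = {..<2 * m},
     ends = \<lambda>e. {e div 2, (e div 2 + 1 + e mod 2) mod m},
     sgn_of = \<lambda>e. if e div 2 + 1 + e mod 2 < m then Pos else Neg\<rparr>"

lemma cycle_square_simps [simp]:
  "verts (cycle_square m) = {..<m}"
  "edges (cycle_square m) = {..<2 * m}"
  "ends (cycle_square m) (2 * i) = {i, Suc i mod m}"
  "ends (cycle_square m) (Suc (2 * i)) = {i, Suc (Suc i) mod m}"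
  "sgn_of (cycle_square m) (2 * i) = (if Suc i < m then Pos else Neg)"
  "sgn_of (cycle_square m) (Suc (2 * i)) = (if Suc (Suc i) < m then Pos else Neg)"
  by (simp_all add: cycle_square_def)

lemma cycle_square_edge_cases:
  assumes "e \<in> edges (cycle_square m)"
  obtains (short) i where "i < m" "e = 2 * i" | (long) i where "i < m" "e = Suc (2 * i)"
  using assms by (cases "even e") (auto elim!: evenE oddE)

lemma signed_graph_cycle_square: "signed_graph (cycle_square m)"
proof -
  have "\<exists>x\<in>{..<m}. \<exists>y\<in>{..<m}. ends (cycle_square m) e = {x, y}" if "e \<in> {..<2 * m}" for e
    using that by (intro bexI[of _ "e div 2"] bexI[of _ "(e div 2 + 1 + e mod 2) mod m"])
      (auto simp: cycle_square_def)
  then show ?thesis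
    by (simp add: signed_graph_def)
qed

lemma cyclic_arcs_meet_imp_eq:
  fixes d i j m :: nat and n :: int and s t :: real
  assumes "d dvd m" "i mod d = j mod d" "i < m" "j < m"
    and "0 \<le> s" "s < 1" "0 \<le> t" "t < 1"
    and eq: "real i + real d * s = real j + real d * t + of_int n * real m"
  shows "i = j \<and> s = t"
proof -
  have "int d dvd int j - int i + n * int m"
    using assms(1,2) by (metis dvd_add dvd_mult int_dvd_int_iff mod_eq_dvd_iff zmod_int)
  then obtain k where k: "int j - int i + n * int m = int d * k" ..
  have "d > 0"
    using assms(1,3) by (metis dvd_0_left_iff not_gr0 not_less_zero)
  have "real d * (s - t) = real_of_int (int j - int i + n * int m)"
    using eq by (simp add: algebra_simps)
  also have "\<dots> = real d * k"
    unfolding k by simp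
  finally have "s - t = k"
    using \<open>d > 0\<close> by simp
  then have "k = 0"
    using assms(5-8) by linarith
  then have "int i mod int m = (int j + n * int m) mod int m"
    using k by (simp add: algebra_simps)
  then have "i = j"
    using assms(3,4) by simp
  then show ?thesis
    using \<open>s - t = k\<close> \<open>k = 0\<close> by simp
qed

text \<open>
  The exponential maps the cylinder onto the punctured plane. On the cylinder the even vertices lie
  at height 0, the odd ones at height 1, and vertex \<open>v\<close> has angle \<open>v\<close> (in units of \<open>2\<pi>/m\<close>).
  The short edges zigzag between the two heights, the long ones are horizontal.
\<close>

definition antiprism_vertex :: "nat \<Rightarrow> nat \<Rightarrow> complex" where
  "antiprism_vertex m v = cylinder_point m (of_bool (odd v)) v"

definition antiprism_edge :: "nat \<Rightarrow> nat \<Rightarrow> real \<Rightarrow> complex" where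
  "antiprism_edge m e t = cylinder_point m
     (if even e then \<bar>of_bool (odd (e div 2)) - t\<bar> else of_bool (odd (e div 2)))
     (real (e div 2) + real (1 + e mod 2) * t)"

lemma antiprism_edge_simps:
  "antiprism_edge m (2 * i) t = cylinder_point m \<bar>of_bool (odd i) - t\<bar> (real i + t)"
  "antiprism_edge m (Suc (2 * i)) t = cylinder_point m (of_bool (odd i)) (real i + 2 * t)"
  by (simp_all add: antiprism_edge_def)

lemma path_antiprism_edge: "path (antiprism_edge m e)"
  unfolding path_def antiprism_edge_def by (cases "even e") (auto intro!: continuous_intros)

lemma antiprism_vertex_mod:
  assumes "even m"
  shows "antiprism_vertex m (v mod m) = antiprism_vertex m v"
proof (cases "m = 0")
  case False
  have "real v = real (v mod m) + of_int (int (v div m)) * real m"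
    by (metis mod_div_mult_eq of_int_of_nat_eq of_nat_add of_nat_mult)
  then have "\<exists>n::int. real v = real (v mod m) + of_int n * real m" ..
  moreover have "odd (v mod m) = odd v"
    using assms by (simp add: dvd_mod_iff)
  ultimately have "antiprism_vertex m v = antiprism_vertex m (v mod m)"
    using False by (simp add: antiprism_vertex_def cylinder_point_eq_iff)
  then show ?thesis ..
qed simp

lemma antiprism_edge_endpoints:
  assumes "even m"
  shows "{pathstart (antiprism_edge m e), pathfinish (antiprism_edge m e)} =
    antiprism_vertex m ` ends (cycle_square m) e"
proof (cases "even e")
  case True
  then obtain i where "e = 2 * i" ..
  then show ?thesis
    by (simp add: pathstart_def pathfinish_def antiprism_edge_simps antiprism_vertex_mod[OF assms])
      (simp add: antiprism_vertex_def add.commute)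
next
  case False
  then obtain i where "e = Suc (2 * i)"
    by (metis oddE Suc_eq_plus1)
  then show ?thesis
    by (simp add: pathstart_def pathfinish_def antiprism_edge_simps antiprism_vertex_mod[OF assms])
      (simp add: antiprism_vertex_def add.commute)
qed

lemma inj_on_antiprism_vertex: "inj_on (antiprism_vertex m) {..<m}"
proof (rule inj_onI)
  fix v w assume "v \<in> {..<m}" "w \<in> {..<m}" "antiprism_vertex m v = antiprism_vertex m w"
  then show "v = w"
    using cyclic_arcs_meet_imp_eq[of 1 m v w 0 0]
    by (auto simp: antiprism_vertex_def cylinder_point_eq_iff)
qed

lemma antiprism_long_edges_meet_imp_eq:
  assumes "even m" "i < m" "j < m" "s \<in> {0..<1}" "t \<in> {0..<1}"
    and "antiprism_edge m (Suc (2 * i)) s = antiprism_edge m (Suc (2 * j)) t"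
  shows "i = j \<and> s = t"
proof -
  have "odd i \<longleftrightarrow> odd j"
    and "\<exists>n::int. real i + real 2 * s = real j + real 2 * t + of_int n * real m"
    using assms(2,6) by (simp_all add: antiprism_edge_simps cylinder_point_eq_iff of_bool_eq_iff)
  then obtain n :: int where "i mod 2 = j mod 2"
      "real i + real 2 * s = real j + real 2 * t + of_int n * real m"
    by (auto simp: mod2_eq_if)
  then show ?thesis
    using assms cyclic_arcs_meet_imp_eq[of 2 m i j s t n] by simp
qed

lemma antiprism_short_edges_meet_imp_eq:
  assumes "i < m" "j < m" "s \<in> {0..<1}" "t \<in> {0..<1}"
    and "antiprism_edge m (2 * i) s = antiprism_edge m (2 * j) t"
  shows "i = j \<and> s = t"
proof -
  obtain n :: int where "real i + real 1 * s = real j + real 1 * t + of_int n * real m"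
    using assms by (auto simp: antiprism_edge_simps cylinder_point_eq_iff)
  then show ?thesis
    using assms cyclic_arcs_meet_imp_eq[of 1 m i j s t n] by simp
qed

lemma antiprism_short_edge_neq_long_edge:
  assumes "m > 0" "s \<in> {0<..<1}"
  shows "antiprism_edge m (2 * i) s \<noteq> antiprism_edge m (Suc (2 * j)) t"
proof -
  have "\<bar>of_bool (odd i) - s\<bar> \<noteq> of_bool (odd j)"
    using assms(2) by (auto simp: of_bool_def)
  then show ?thesis
    using assms(1) by (simp add: antiprism_edge_simps cylinder_point_eq_iff)
qed

lemma antiprism_vertex_eq_edge: "antiprism_vertex m v = antiprism_edge m (Suc (2 * v)) 0"
  by (simp add: antiprism_vertex_def antiprism_edge_simps)

lemma antiprism_edges_meet_imp_eq:
  assumes "even m" "e \<in> edges (cycle_square m)" "f \<in> edges (cycle_square m)"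
    and st: "s \<in> {0<..<1}" "t \<in> {0<..<1}" and eq: "antiprism_edge m e s = antiprism_edge m f t"
  shows "e = f \<and> s = t"
  using assms(2)
proof (cases rule: cycle_square_edge_cases)
  case e: (short i)
  show ?thesis
    using assms(3)
  proof (cases rule: cycle_square_edge_cases)
    case (short j)
    then show ?thesis
      using antiprism_short_edges_meet_imp_eq[of i m j s t] e st eq by simp
  next
    case (long j)
    then show ?thesis
      using antiprism_short_edge_neq_long_edge[of m s i j t] e st eq by simp
  qed
next
  case e: (long i)
  show ?thesis
    using assms(3)
  proof (cases rule: cycle_square_edge_cases)
    case (short j)
    then show ?thesis
      using antiprism_short_edge_neq_long_edge[of m t j i s] e st eq by simp
  next
    case (long j)
    then show ?thesis
      using antiprism_long_edges_meet_imp_eq[of m i j s t] assms(1) e st eq by simp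
  qed
qed

lemma antiprism_edge_neq_vertex:
  assumes "even m" "e \<in> edges (cycle_square m)" "v < m" "t \<in> {0<..<1}"
  shows "antiprism_edge m e t \<noteq> antiprism_vertex m v"
  using assms(2)
proof (cases rule: cycle_square_edge_cases)
  case (short i)
  then show ?thesis
    using antiprism_short_edge_neq_long_edge[of m t i v 0] assms(4)
    by (simp add: antiprism_vertex_eq_edge)
next
  case (long i)
  then show ?thesis
    using antiprism_long_edges_meet_imp_eq[of m i v t 0] assms
    by (auto simp: antiprism_vertex_eq_edge)
qed

lemma planar_drawing_cycle_square:
  assumes "even m"
  shows "planar_drawing (cycle_square m) (antiprism_vertex m) (antiprism_edge m)"
proof (rule planar_drawingI)
  show "signed_graph (cycle_square m)"
    by (rule signed_graph_cycle_square)
  show "inj_on (antiprism_vertex m) (verts (cycle_square m))"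
    by (simp add: inj_on_antiprism_vertex)
qed (use assms path_antiprism_edge antiprism_edge_endpoints antiprism_edge_neq_vertex
    antiprism_edges_meet_imp_eq in auto)

subsection \<open>Switching and frustration\<close>

definition edge_cut :: "('v, 'e) sgraph \<Rightarrow> 'v set \<Rightarrow> 'e set" where
  "edge_cut G S = {e \<in> edges G. ends G e \<inter> S \<noteq> {} \<and> \<not> ends G e \<subseteq> S}"

definition switched_neg_edges :: "('v, 'e) sgraph \<Rightarrow> 'v set \<Rightarrow> 'e set" where
  "switched_neg_edges G S = sym_diff (neg_edges G) (edge_cut G S)"

lemma in_switched_neg_edges_iff:
  assumes "e \<in> edges G" "ends G e = {x, y}"
  shows "e \<in> switched_neg_edges G S \<longleftrightarrow> (sgn_of G e = Neg) \<noteq> ((x \<in> S) \<noteq> (y \<in> S))"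
  using assms by (auto simp: switched_neg_edges_def neg_edges_def edge_cut_def)

lemma switched_neg_edges_subset: "switched_neg_edges G S \<subseteq> edges G"
  by (auto simp: switched_neg_edges_def neg_edges_def edge_cut_def)

lemma finite_switched_neg_edges: "signed_graph G \<Longrightarrow> finite (switched_neg_edges G S)"
  using switched_neg_edges_subset finite_subset unfolding signed_graph_def by metis

lemma switched_neg_edges_empty: "switched_neg_edges G {} = neg_edges G"
  by (simp add: switched_neg_edges_def edge_cut_def)

lemma switched_neg_edges_Int_verts:
  assumes "signed_graph G"
  shows "switched_neg_edges G (S \<inter> verts G) = switched_neg_edges G S"
proof -
  have "edge_cut G (S \<inter> verts G) = edge_cut G S"
    using ends_subset_verts[OF assms] by (fastforce simp: edge_cut_def)
  then show ?thesis
    by (simp add: switched_neg_edges_def)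
qed

lemma edge_cut_sym_diff:
  assumes "signed_graph G"
  shows "edge_cut G (sym_diff S T) = sym_diff (edge_cut G S) (edge_cut G T)"
proof (rule set_eqI)
  fix e
  show "e \<in> edge_cut G (sym_diff S T) \<longleftrightarrow> e \<in> sym_diff (edge_cut G S) (edge_cut G T)"
  proof (cases "e \<in> edges G")
    case True
    then obtain x y where "ends G e = {x, y}"
      using assms unfolding signed_graph_def by blast
    then have "e \<in> edge_cut G U \<longleftrightarrow> (x \<in> U) \<noteq> (y \<in> U)" for U
      using True by (auto simp: edge_cut_def)
    then show ?thesis
      by simp blast
  qed (simp add: edge_cut_def)
qed

lemma neg_edges_switch_at: "neg_edges (switch_at v G) = sym_diff (neg_edges G) (edge_cut G {v})"
proof -
  have "opposite s = Neg \<longleftrightarrow> s \<noteq> Neg" for s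
    by (cases s) auto
  then show ?thesis
    by (auto simp: neg_edges_def edge_cut_def switch_at_def)
qed

lemma switching_equiv_structure:
  assumes "switching_equiv G H"
  shows "verts H = verts G" "edges H = edges G" "ends H = ends G"
  using assms by induction (auto simp: switch_at_def)

lemma neg_edges_switch_at_switched:
  assumes "signed_graph G" "switching_equiv G H" "neg_edges H = switched_neg_edges G S"
  shows "neg_edges (switch_at v H) = switched_neg_edges G (sym_diff S {v})"
proof -
  have "edge_cut H {v} = edge_cut G {v}"
    by (simp add: edge_cut_def switching_equiv_structure[OF assms(2)])
  then show ?thesis
    by (auto simp: neg_edges_switch_at assms(3) switched_neg_edges_def
        edge_cut_sym_diff[OF assms(1)])
qed

lemma switching_equiv_imp_switched_neg_edges:
  assumes "signed_graph G" "switching_equiv G H"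
  shows "\<exists>S. neg_edges H = switched_neg_edges G S"
  using assms(2)
proof induction
  case refl
  show ?case
    using switched_neg_edges_empty by metis
next
  case (switch H v)
  then show ?case
    using neg_edges_switch_at_switched[OF assms(1)] by blast
qed

lemma switched_neg_edges_imp_switching_equiv:
  assumes "finite S" "signed_graph G" "S \<subseteq> verts G"
  shows "\<exists>H. switching_equiv G H \<and> neg_edges H = switched_neg_edges G S"
  using assms
proof (induction S)
  case empty
  show ?case
    using switching_equiv.refl switched_neg_edges_empty by metis
next
  case (insert v S)
  then obtain H where H: "switching_equiv G H" "neg_edges H = switched_neg_edges G S"
    by auto
  have "sym_diff S {v} = insert v S"
    using insert.hyps by auto
  then have "neg_edges (switch_at v H) = switched_neg_edges G (insert v S)"
    using neg_edges_switch_at_switched[OF \<open>signed_graph G\<close> H, of v] by simp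
  moreover have "switching_equiv G (switch_at v H)"
    using H(1) insert.prems by (auto intro: switching_equiv.switch)
  ultimately show ?case
    by blast
qed

lemma frustration_index_le:
  assumes "signed_graph G"
  shows "frustration_index G \<le> card (switched_neg_edges G S)"
proof -
  have "\<exists>H. switching_equiv G H \<and> neg_edges H = switched_neg_edges G (S \<inter> verts G)"
    using assms by (intro switched_neg_edges_imp_switching_equiv) (auto simp: signed_graph_def)
  then have "\<exists>H. switching_equiv G H \<and> card (neg_edges H) = card (switched_neg_edges G S)"
    unfolding switched_neg_edges_Int_verts[OF assms] by metis
  then show ?thesis
    unfolding frustration_index_def by (rule Least_le)
qed

lemma frustration_index_attained:
  assumes "signed_graph G"
  obtains S where "card (switched_neg_edges G S) = frustration_index G"
proof -
  have "\<exists>H. switching_equiv G H \<and> card (neg_edges H) = frustration_index G"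
    unfolding frustration_index_def
    by (rule LeastI[of _ "card (neg_edges G)"]) (auto intro: switching_equiv.refl)
  then show ?thesis
    using switching_equiv_imp_switched_neg_edges[OF assms] that by metis
qed

definition negative_closed_walk :: "('v, 'e) sgraph \<Rightarrow> nat \<Rightarrow> (nat \<Rightarrow> 'v) \<Rightarrow> (nat \<Rightarrow> 'e) \<Rightarrow> bool" where
  "negative_closed_walk G n v e \<longleftrightarrow>
     v n = v 0 \<and> (\<forall>i<n. e i \<in> edges G \<and> ends G (e i) = {v i, v (Suc i)}) \<and>
     odd (card {i \<in> {..<n}. sgn_of G (e i) = Neg})"

lemma negative_closed_walkI:
  assumes "v n = v 0" "\<And>i. i < n \<Longrightarrow> e i \<in> edges G"
    and "\<And>i. i < n \<Longrightarrow> ends G (e i) = {v i, v (Suc i)}"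
    and "k < n" "\<And>i. i < n \<Longrightarrow> sgn_of G (e i) = Neg \<longleftrightarrow> i = k"
  shows "negative_closed_walk G n v e"
proof -
  have "{i \<in> {..<n}. sgn_of G (e i) = Neg} = {k}"
    using assms(4,5) by blast
  then show ?thesis
    using assms(1-3) by (simp add: negative_closed_walk_def)
qed

lemma negative_closed_walk_meets_switched_neg_edges:
  assumes "negative_closed_walk G n v e"
  shows "\<exists>i<n. e i \<in> switched_neg_edges G S"
proof (rule ccontr)
  assume not_switched: "\<not> ?thesis"
  have walk: "e i \<in> edges G" "ends G (e i) = {v i, v (Suc i)}" if "i < n" for i
    using assms that by (simp_all add: negative_closed_walk_def)
  have sgn: "sgn_of G (e i) = Neg \<longleftrightarrow> (v i \<in> S) \<noteq> (v (Suc i) \<in> S)" if "i < n" for i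
    using not_switched in_switched_neg_edges_iff[OF walk[OF that]] that by blast
  have parity: "odd (card {i \<in> {..<j}. sgn_of G (e i) = Neg}) \<longleftrightarrow> (v 0 \<in> S) \<noteq> (v j \<in> S)"
    if "j \<le> n" for j
    using that
  proof (induction j)
    case 0
    show ?case by simp
  next
    case (Suc j)
    let ?N = "{i \<in> {..<j}. sgn_of G (e i) = Neg}"
    have "{i \<in> {..<Suc j}. sgn_of G (e i) = Neg} =
        (if sgn_of G (e j) = Neg then insert j ?N else ?N)"
      by (cases "sgn_of G (e j) = Neg"; force simp: less_Suc_eq)
    then show ?case
      using Suc sgn[of j] by simp
  qed
  have "v n = v 0" and "odd (card {i \<in> {..<n}. sgn_of G (e i) = Neg})"
    using assms by (simp_all add: negative_closed_walk_def)
  then show False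
    using parity[of n] by simp
qed

lemma card_disjoint_negative_closed_walks_le_frustration_index:
  assumes "signed_graph G" "disjoint \<C>"
    and walks: "\<And>C. C \<in> \<C> \<Longrightarrow> \<exists>n v e. negative_closed_walk G n v e \<and> C = e ` {..<n}"
  shows "card \<C> \<le> frustration_index G"
proof -
  obtain S where S: "card (switched_neg_edges G S) = frustration_index G"
    using frustration_index_attained[OF assms(1)] .
  have meets: "\<forall>C\<in>\<C>. \<exists>a. a \<in> C \<inter> switched_neg_edges G S"
  proof
    fix C assume "C \<in> \<C>"
    then obtain n v e where "negative_closed_walk G n v e" "C = e ` {..<n}"
      using walks[of C] by blast
    then show "\<exists>a. a \<in> C \<inter> switched_neg_edges G S"
      using negative_closed_walk_meets_switched_neg_edges[of G n v e S] by blast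
  qed
  obtain h where h: "\<forall>C\<in>\<C>. h C \<in> C \<inter> switched_neg_edges G S"
    using bchoice[OF meets] ..
  have "inj_on h \<C>"
  proof (rule inj_onI)
    fix C D assume CD: "C \<in> \<C>" "D \<in> \<C>" "h C = h D"
    then have "h C \<in> C \<inter> D"
      using h by force
    then show "C = D"
      using disjointD[OF assms(2) CD(1,2)] by blast
  qed
  then have "card \<C> \<le> card (switched_neg_edges G S)"
    using h finite_switched_neg_edges[OF assms(1)] by (intro card_inj_on_le) auto
  then show ?thesis
    by (simp add: S)
qed

lemma signed_graph_del_edge: "signed_graph G \<Longrightarrow> signed_graph (del_edge G e)"
  by (auto simp: signed_graph_def del_edge_def)

lemma switched_neg_edges_del_edge:
  "switched_neg_edges (del_edge G e) S = switched_neg_edges G S - {e}"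
  by (auto simp: switched_neg_edges_def neg_edges_def edge_cut_def del_edge_def)

lemma frustration_index_del_edge_drops_iff:
  assumes "signed_graph G"
  shows "frustration_index (del_edge G e) + 1 = frustration_index G \<longleftrightarrow>
    (\<exists>S. e \<in> switched_neg_edges G S \<and> card (switched_neg_edges G S) = frustration_index G)"
    (is "?lhs \<longleftrightarrow> ?rhs")
proof -
  note finite = finite_switched_neg_edges[OF assms]
  have card_del: "card (switched_neg_edges (del_edge G e) S) +
      of_bool (e \<in> switched_neg_edges G S) = card (switched_neg_edges G S)" for S
    using card_Suc_Diff1[OF finite, of e S] by (simp add: switched_neg_edges_del_edge)
  obtain T where T: "card (switched_neg_edges (del_edge G e) T) = frustration_index (del_edge G e)"
    using frustration_index_attained[OF signed_graph_del_edge[OF assms]] .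
  have T_ge: "frustration_index G \<le> card (switched_neg_edges G T)"
    by (rule frustration_index_le[OF assms])
  show ?thesis
  proof
    assume ?lhs
    then have "e \<in> switched_neg_edges G T \<and> card (switched_neg_edges G T) = frustration_index G"
      using T T_ge card_del[of T] by (cases "e \<in> switched_neg_edges G T") auto
    then show ?rhs ..
  next
    assume ?rhs
    then obtain S where "e \<in> switched_neg_edges G S"
        "card (switched_neg_edges G S) = frustration_index G"
      by blast
    then have "frustration_index (del_edge G e) + 1 \<le> frustration_index G"
      using frustration_index_le[OF signed_graph_del_edge[OF assms], of e S] card_del[of S] by simp
    moreover have "frustration_index G \<le> frustration_index (del_edge G e) + 1"
      using T T_ge card_del[of T] by (cases "e \<in> switched_neg_edges G T") auto
    ultimately show ?lhs
      by simp
  qed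
qed

lemma critically_frustrated_iff:
  assumes "signed_graph G"
  shows "critically_frustrated k G \<longleftrightarrow> frustration_index G = k \<and>
    (\<forall>e\<in>edges G. \<exists>S. e \<in> switched_neg_edges G S \<and> card (switched_neg_edges G S) = k)"
  using frustration_index_del_edge_drops_iff[OF assms] by (auto simp: critically_frustrated_def)

subsection \<open>Subdivision vertices\<close>

definition neighbours :: "('v, 'e) sgraph \<Rightarrow> 'v \<Rightarrow> 'v set" where
  "neighbours G v = {u. \<exists>e\<in>edges G. ends G e = {v, u}}"

lemma neighboursI: "e \<in> edges G \<Longrightarrow> ends G e = {v, u} \<Longrightarrow> u \<in> neighbours G v"
  by (auto simp: neighbours_def)

lemma finite_neighbours:
  assumes "signed_graph G"
  shows "finite (neighbours G v)"
proof (rule finite_subset)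
  show "neighbours G v \<subseteq> verts G"
    using ends_subset_verts[OF assms] by (fastforce simp: neighbours_def)
  show "finite (verts G)"
    using assms by (simp add: signed_graph_def)
qed

definition no_subdivision_vertex :: "('v, 'e) sgraph \<Rightarrow> bool" where
  "no_subdivision_vertex G \<longleftrightarrow> (\<forall>v\<in>verts G. v \<in> neighbours G v \<or> 3 \<le> card (neighbours G v))"

lemma no_isolated_vertices_if_no_subdivision_vertex:
  assumes "no_subdivision_vertex G"
  shows "no_isolated_vertices G"
  unfolding no_isolated_vertices_def
proof
  fix v assume "v \<in> verts G"
  then have "neighbours G v \<noteq> {}"
    using assms by (force simp: no_subdivision_vertex_def)
  then show "\<exists>e\<in>edges G. v \<in> ends G e"
    by (auto simp: neighbours_def)
qed

lemma subdivides_to_imp_not_no_subdivision_vertex: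
  assumes "subdivides_to H G"
  shows "\<not> no_subdivision_vertex G"
proof -
  obtain x y s M w A B where
    w: "w \<notin> verts H" "w \<in> verts G"
    and E: "edges G = (edges H - M) \<union> A \<union> B"
    and old: "\<forall>e\<in>edges H - M. ends G e = ends H e"
    and A: "multiedge G x w s A" and B: "multiedge G w y Pos B"
    using assms unfolding subdivides_to_def by (elim conjE exE) simp
  have "signed_graph H"
    using assms by (simp add: subdivides_to_def)
  then have "w \<notin> ends G e" if "e \<in> edges H - M" for e
    using ends_subset_verts[of H e] old w(1) that by auto
  then have "neighbours G w \<subseteq> {x, y}"
    using E A B by (fastforce simp: neighbours_def multiedge_def doubleton_eq_iff)
  moreover have "card {x, y} \<le> 2"
    by (simp add: card_insert_if)
  ultimately have "card (neighbours G w) \<le> 2"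
    by (meson card_mono finite.emptyI finite.insertI order_trans)
  moreover have "w \<notin> neighbours G w"
    using \<open>neighbours G w \<subseteq> {x, y}\<close> A B by (auto simp: multiedge_def)
  ultimately show ?thesis
    using w(2) by (force simp: no_subdivision_vertex_def)
qed

lemma irreducible_sgraph_if_no_subdivision_vertex:
  assumes "no_subdivision_vertex G"
  shows "irreducible_sgraph G"
proof -
  have "\<not> proper_subdivision G' H" if "switching_equiv G G'" for G' H
  proof
    assume "proper_subdivision G' H"
    then obtain K where "subdivides_to K G'"
      unfolding proper_subdivision_def by (auto elim: tranclp.cases)
    moreover have "no_subdivision_vertex G'"
      using assms switching_equiv_structure[OF that]
      by (simp add: no_subdivision_vertex_def neighbours_def)
    ultimately show False
      using subdivides_to_imp_not_no_subdivision_vertex by blast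
  qed
  then show ?thesis
    by (auto simp: irreducible_sgraph_def)
qed

subsection \<open>Adding a negative loop\<close>

definition add_negative_loop :: "'v \<Rightarrow> 'e \<Rightarrow> ('v, 'e) sgraph \<Rightarrow> ('v, 'e) sgraph" where
  "add_negative_loop v e G = \<lparr>verts = insert v (verts G), edges = insert e (edges G),
     ends = (ends G)(e := {v}), sgn_of = (sgn_of G)(e := Neg)\<rparr>"

lemma signed_graph_add_negative_loop:
  assumes "signed_graph G"
  shows "signed_graph (add_negative_loop v e G)"
proof -
  have "\<exists>x\<in>insert v (verts G). \<exists>y\<in>insert v (verts G). ((ends G)(e := {v})) a = {x, y}"
    if "a \<in> insert e (edges G)" for a
  proof (cases "a = e")
    case False
    then show ?thesis
      using assms that unfolding signed_graph_def by (metis fun_upd_other insert_iff)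
  qed simp
  then show ?thesis
    using assms by (simp add: signed_graph_def add_negative_loop_def)
qed

lemma no_subdivision_vertex_add_negative_loop:
  assumes "no_subdivision_vertex G" "e \<notin> edges G"
  shows "no_subdivision_vertex (add_negative_loop v e G)"
proof -
  have "a \<noteq> e" if "a \<in> edges G" for a
    using that assms(2) by blast
  then have "neighbours (add_negative_loop v e G) u = {w. {v} = {u, w}} \<union> neighbours G u" for u
    by (simp add: neighbours_def add_negative_loop_def Collect_disj_eq cong: bex_cong)
  moreover have "{w. {v} = {u, w}} = (if u = v then {v} else {})" for u
    by (simp add: singleton_insert_inj_eq' Collect_conv_if)
  ultimately have "neighbours (add_negative_loop v e G) u =
      (if u = v then insert v (neighbours G u) else neighbours G u)" for u
    by simp
  then show ?thesis
    using assms(1) by (auto simp: no_subdivision_vertex_def add_negative_loop_def)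
qed

lemma switched_neg_edges_add_negative_loop:
  assumes "e \<notin> edges G"
  shows "switched_neg_edges (add_negative_loop v e G) S = insert e (switched_neg_edges G S)"
  using assms
  by (auto simp: switched_neg_edges_def neg_edges_def edge_cut_def add_negative_loop_def)

lemma card_switched_neg_edges_add_negative_loop:
  assumes "signed_graph G" "e \<notin> edges G"
  shows "card (switched_neg_edges (add_negative_loop v e G) S) =
    Suc (card (switched_neg_edges G S))"
proof -
  have "e \<notin> switched_neg_edges G S"
    using assms(2) switched_neg_edges_subset by fast
  then show ?thesis
    by (simp add: switched_neg_edges_add_negative_loop finite_switched_neg_edges assms)
qed

lemma frustration_index_add_negative_loop:
  assumes "signed_graph G" "e \<notin> edges G"
  shows "frustration_index (add_negative_loop v e G) = Suc (frustration_index G)"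
proof (rule antisym)
  note G' = signed_graph_add_negative_loop[OF assms(1), of v e]
  note card = card_switched_neg_edges_add_negative_loop[OF assms, of v]
  show "frustration_index (add_negative_loop v e G) \<le> Suc (frustration_index G)"
    using frustration_index_attained[OF assms(1)] frustration_index_le[OF G'] card by metis
  show "Suc (frustration_index G) \<le> frustration_index (add_negative_loop v e G)"
    using frustration_index_attained[OF G'] frustration_index_le[OF assms(1)] card
    by (metis Suc_le_mono)
qed

lemma critically_frustrated_add_negative_loop:
  assumes G: "signed_graph G" and e: "e \<notin> edges G" and crit: "critically_frustrated k G"
  shows "critically_frustrated (Suc k) (add_negative_loop v e G)"
proof -
  let ?G' = "add_negative_loop v e G"
  note switched = switched_neg_edges_add_negative_loop[OF e, of v]
    card_switched_neg_edges_add_negative_loop[OF G e, of v]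
  have k: "frustration_index G = k"
    and negative: "\<And>a. a \<in> edges G \<Longrightarrow>
      \<exists>S. a \<in> switched_neg_edges G S \<and> card (switched_neg_edges G S) = k"
    using crit by (auto simp: critically_frustrated_iff[OF G])
  obtain T where "card (switched_neg_edges G T) = k"
    using frustration_index_attained[OF G] k by metis
  then have "\<exists>S. a \<in> switched_neg_edges ?G' S \<and> card (switched_neg_edges ?G' S) = Suc k"
    if "a \<in> edges ?G'" for a
    using negative[of a] that switched by (auto simp: add_negative_loop_def)
  then show ?thesis
    by (simp add: critically_frustrated_iff signed_graph_add_negative_loop
        frustration_index_add_negative_loop G e k)
qed

lemma interior_subset_path_image: "g ` {0<..<1} \<subseteq> path_image g"
  by (auto simp: path_image_def)

lemma norm_cylinder_point: "norm (cylinder_point L h x) = exp h"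
  by (simp add: cylinder_point_def norm_exp_eq_Re)

lemma obtain_simple_loop_avoiding_bounded:
  fixes S :: "complex set"
  assumes "bounded S"
  obtains g where "simple_path g" "pathfinish g = pathstart g" "path_image g \<inter> S = {}"
proof -
  obtain R where R: "\<forall>z\<in>S. cmod z \<le> R"
    using assms by (auto simp: bounded_iff)
  define g where "g t = of_real (R + 2) + cylinder_point 1 0 t" for t
  have eq: "g s = g t \<longleftrightarrow> (\<exists>n::int. s = t + of_int n)" for s t
    by (simp add: g_def cylinder_point_eq_iff)
  have "s = t \<or> s = 0 \<and> t = 1 \<or> s = 1 \<and> t = 0"
    if st: "s \<in> {0..1}" "t \<in> {0..1}" and "g s = g t" for s t
  proof -
    obtain n :: int where n: "s = t + of_int n"
      using \<open>g s = g t\<close> eq by blast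
    then have "n = -1 \<or> n = 0 \<or> n = 1"
      using st by auto
    then show ?thesis
      using n st by auto
  qed
  moreover have "path g"
    unfolding path_def g_def by (intro continuous_intros)
  ultimately have "simple_path g"
    by (simp add: simple_path_def loop_free_def)
  moreover have "g 1 = g 0"
    unfolding eq by (rule exI[of _ 1]) simp
  moreover have "g t \<notin> S" for t
  proof -
    have "R + 2 - 1 \<le> cmod (g t)"
      using norm_diff_ineq[of "of_real (R + 2)" "cylinder_point 1 0 t"]
      by (simp add: g_def norm_cylinder_point)
    then show ?thesis
      using R by force
  qed
  ultimately show ?thesis
    using that[of g] by (auto simp: path_image_def pathstart_def pathfinish_def)
qed

lemma planar_drawing_add_negative_loop:
  assumes G: "signed_graph G" and drawing: "planar_drawing G p c" and v: "v \<notin> verts G"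
    and loop: "simple_path g" "pathfinish g = pathstart g"
    and avoids: "path_image g \<inter> (p ` verts G \<union> (\<Union>a\<in>edges G. path_image (c a))) = {}"
  shows "planar_drawing (add_negative_loop v e G) (p(v := pathstart g)) (c(e := g))"
proof -
  let ?p = "p(v := pathstart g)" and ?c = "c(e := g)" and ?G' = "add_negative_loop v e G"
  have interior_loop: "g ` {0<..<1} = path_image g - {pathstart g}"
    using simple_path_endless[OF loop(1)] loop(2) by simp
  have start: "pathstart g \<notin> p ` verts G"
    using avoids pathstart_in_path_image[of g] by blast
  have p_verts: "?p ` verts ?G' = insert (pathstart g) (p ` verts G)"
    using v by (auto simp: add_negative_loop_def)
  have old: "pathstart g \<notin> c a ` {0<..<1}" "g ` {0<..<1} \<inter> c a ` {0<..<1} = {}"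
      "?p ` ends G a = p ` ends G a" if a: "a \<in> edges G" for a
    using a avoids interior_subset_path_image[of g] interior_subset_path_image[of "c a"]
      pathstart_in_path_image[of g] ends_subset_verts[OF G a] v by (blast, blast, auto)
  have "inj_on ?p (verts ?G')"
    using inj_on_fun_updI[of p "verts G" "pathstart g" v] drawing start v
    by (auto simp: planar_drawing_def add_negative_loop_def fun_upd_image)
  moreover have "simple_path (?c a) \<and> {pathstart (?c a), pathfinish (?c a)} = ?p ` ends ?G' a \<and>
      ?c a ` {0<..<1} \<inter> ?p ` verts ?G' = {}" if "a \<in> edges ?G'" for a
  proof (cases "a = e")
    case True
    then show ?thesis
      using loop interior_loop avoids unfolding p_verts by (auto simp: add_negative_loop_def)
  next
    case False
    then show ?thesis
      using that drawing old[of a] unfolding p_verts planar_drawing_def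
      by (simp add: add_negative_loop_def)
  qed
  moreover have "?c a ` {0<..<1} \<inter> ?c b ` {0<..<1} = {}"
    if "a \<in> edges ?G'" "b \<in> edges ?G'" "a \<noteq> b" for a b
  proof -
    have "c a ` {0<..<1} \<inter> c b ` {0<..<1} = {}" if "a \<in> edges G" "b \<in> edges G"
      using drawing that \<open>a \<noteq> b\<close> by (simp add: planar_drawing_def)
    then show ?thesis
      using that old(2)[of a] old(2)[of b]
      by (cases "a = e"; cases "b = e") (simp_all add: add_negative_loop_def Int_commute)
  qed
  ultimately show ?thesis
    by (simp add: planar_drawing_def)
qed

lemma planar_add_negative_loop:
  assumes G: "signed_graph G" and "planar G" and v: "v \<notin> verts G"
  shows "planar (add_negative_loop v e G)"
proof -
  obtain p c where drawing: "planar_drawing G p c"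
    using \<open>planar G\<close> by (auto simp: planar_iff_planar_drawing)
  then have "bounded (p ` verts G \<union> (\<Union>a\<in>edges G. path_image (c a)))"
    using G by (auto simp: planar_drawing_def signed_graph_def intro: bounded_simple_path_image)
  then obtain g where "simple_path g" "pathfinish g = pathstart g"
    and "path_image g \<inter> (p ` verts G \<union> (\<Union>a\<in>edges G. path_image (c a))) = {}"
    by (rule obtain_simple_loop_avoiding_bounded)
  then have "planar_drawing (add_negative_loop v e G) (p(v := pathstart g)) (c(e := g))"
    by (rule planar_drawing_add_negative_loop[OF G drawing v])
  then show ?thesis
    unfolding planar_iff_planar_drawing by blast
qed

subsection \<open>Criticality of the squares of cycles\<close>

lemma no_subdivision_vertex_cycle_square:
  assumes "m \<ge> 4"
  shows "no_subdivision_vertex (cycle_square m)"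
  unfolding no_subdivision_vertex_def
proof
  fix v assume "v \<in> verts (cycle_square m)"
  then have v: "v < m" by simp
  define u where "u = (if v = 0 then m - 1 else v - 1)"
  have u: "u < m" "Suc u mod m = v"
    using v by (auto simp: u_def)
  have "Suc v mod m \<in> neighbours (cycle_square m) v"
    by (rule neighboursI[of "2 * v"]) (use v in simp_all)
  moreover have "Suc (Suc v) mod m \<in> neighbours (cycle_square m) v"
    by (rule neighboursI[of "Suc (2 * v)"]) (use v in simp_all)
  moreover have "u \<in> neighbours (cycle_square m) v"
    by (rule neighboursI[of "2 * u"]) (use u in auto)
  moreover have "finite (neighbours (cycle_square m) v)"
    by (rule finite_neighbours[OF signed_graph_cycle_square])
  moreover have "card {Suc v mod m, Suc (Suc v) mod m, u} = 3"
    using v assms by (auto simp: u_def mod_Suc)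
  ultimately show "v \<in> neighbours (cycle_square m) v \<or> 3 \<le> card (neighbours (cycle_square m) v)"
    using card_mono[of "neighbours (cycle_square m) v" "{Suc v mod m, Suc (Suc v) mod m, u}"]
    by simp
qed

lemma short_in_switched_neg_edges_atMost_iff:
  assumes "i < m" "q < m"
  shows "2 * i \<in> switched_neg_edges (cycle_square m) {..q} \<longleftrightarrow> i = q"
  using assms in_switched_neg_edges_iff[of "2 * i" "cycle_square m" i "Suc i mod m" "{..q}"]
  by (auto simp: mod_Suc)

lemma long_in_switched_neg_edges_atMost_iff:
  assumes "m \<ge> 2" "i < m" "q < m"
  shows "Suc (2 * i) \<in> switched_neg_edges (cycle_square m) {..q} \<longleftrightarrow> i = q \<or> Suc i mod m = q"
proof -
  have mem: "Suc (2 * i) \<in> switched_neg_edges (cycle_square m) {..q} \<longleftrightarrow>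
      \<not> Suc (Suc i) < m \<longleftrightarrow> (i \<le> q \<longleftrightarrow> Suc (Suc i) mod m \<le> q)"
    using assms(2)
      in_switched_neg_edges_iff[of "Suc (2 * i)" "cycle_square m" i "Suc (Suc i) mod m" "{..q}"]
    by simp
  consider (forward) "Suc (Suc i) < m" | (to_0) "Suc (Suc i) = m" | (to_1) "Suc i = m"
    using assms(2) by linarith
  then show ?thesis
  proof cases
    case forward
    then show ?thesis unfolding mem by auto
  next
    case to_0
    then show ?thesis unfolding mem using assms(3) by auto
  next
    case to_1
    then have "Suc (Suc i) mod m = 1"
      using assms(1) by (simp add: mod_Suc)
    then show ?thesis unfolding mem using to_1 assms(1,3) by auto
  qed
qed

lemma negative_closed_walk_cycle_square_short:
  assumes "m > 0"
  shows "negative_closed_walk (cycle_square m) m (\<lambda>i. i mod m) (\<lambda>i. 2 * i)"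
  by (rule negative_closed_walkI[where k = "m - 1"]) (use assms in auto)

lemma negative_closed_walk_cycle_square_long:
  assumes "h > 0" "r < 2"
  shows "negative_closed_walk (cycle_square (2 * h)) h
    (\<lambda>i. (2 * i + r) mod (2 * h)) (\<lambda>i. Suc (2 * (2 * i + r)))"
proof (rule negative_closed_walkI[where k = "h - 1"])
  fix i assume "i < h"
  have "\<not> Suc (Suc (2 * i + r)) < 2 * h \<longleftrightarrow> i = h - 1"
    using assms \<open>i < h\<close> by linarith
  then show "sgn_of (cycle_square (2 * h)) (Suc (2 * (2 * i + r))) = Neg \<longleftrightarrow> i = h - 1"
    by (simp only: cycle_square_simps) auto
  show "ends (cycle_square (2 * h)) (Suc (2 * (2 * i + r))) =
      {(2 * i + r) mod (2 * h), (2 * Suc i + r) mod (2 * h)}"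
    unfolding cycle_square_simps using assms \<open>i < h\<close> by simp
qed (use assms in auto)

lemma frustration_index_cycle_square_ge:
  assumes "even m" "m > 0"
  shows "3 \<le> frustration_index (cycle_square m)"
proof -
  obtain h where h: "m = 2 * h" "h > 0"
    using assms by auto
  define short where "short = (\<lambda>i. 2 * i) ` {..<m}"
  define long where "long r = (\<lambda>i. Suc (2 * (2 * i + r))) ` {..<h}" for r :: nat
  have "2 * i \<noteq> Suc (2 * (2 * j + r))"
      "Suc (2 * (2 * i + 0)) \<noteq> Suc (2 * (2 * j + 1))" for i j r :: nat
    by presburger+
  then have "disjnt short (long r)" "disjnt (long 0) (long 1)" for r
    unfolding short_def long_def disjnt_def by fast+
  then have disjnt: "disjnt short (long r)" "disjnt (long r) short"
      "disjnt (long 0) (long 1)" "disjnt (long 1) (long 0)" for r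
    by (simp_all add: disjnt_sym)
  then have "disjoint {short, long 0, long 1}"
    by (auto simp: pairwise_insert)
  moreover have "\<exists>n v e. negative_closed_walk (cycle_square m) n v e \<and> C = e ` {..<n}"
    if "C \<in> {short, long 0, long 1}" for C
  proof -
    have "\<exists>n v e. negative_closed_walk (cycle_square m) n v e \<and> short = e ` {..<n}"
      unfolding short_def using negative_closed_walk_cycle_square_short[OF assms(2)] by blast
    moreover have "\<exists>n v e. negative_closed_walk (cycle_square m) n v e \<and> long r = e ` {..<n}"
      if "r < 2" for r
      unfolding long_def h(1) using negative_closed_walk_cycle_square_long[OF h(2) that] by blast
    ultimately show ?thesis
      using that by auto
  qed
  ultimately have "card {short, long 0, long 1} \<le> frustration_index (cycle_square m)"
    by (intro card_disjoint_negative_closed_walks_le_frustration_index signed_graph_cycle_square)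
  moreover have "short \<noteq> {}" "long r \<noteq> {}" for r
    using h by (auto simp: short_def long_def lessThan_empty_iff)
  then have "short \<noteq> long 0" "short \<noteq> long 1" "long 0 \<noteq> long 1"
    using disjnt disjnt_self_iff_empty by metis+
  then have "card {short, long 0, long 1} = 3"
    by simp
  ultimately show ?thesis by simp
qed

lemma card_switched_neg_edges_cycle_square_le:
  assumes "m \<ge> 2" "q < m"
  shows "card (switched_neg_edges (cycle_square m) {..q}) \<le> 3"
proof -
  have pred: "i = (q + (m - 1)) mod m" if "i < m" "Suc i mod m = q" for i
  proof -
    have "Suc i + (m - 1) = i + m"
      using that(1) by simp
    then show ?thesis
      using that mod_add_left_eq[of "Suc i" m "m - 1"] by simp
  qed
  have "switched_neg_edges (cycle_square m) {..q} \<subseteq>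
      {2 * q, Suc (2 * q), Suc (2 * ((q + (m - 1)) mod m))}"
  proof
    fix e assume e: "e \<in> switched_neg_edges (cycle_square m) {..q}"
    then have "e \<in> edges (cycle_square m)"
      by (rule subsetD[OF switched_neg_edges_subset])
    then show "e \<in> {2 * q, Suc (2 * q), Suc (2 * ((q + (m - 1)) mod m))}"
    proof (cases rule: cycle_square_edge_cases)
      case (short i)
      then show ?thesis
        using e short_in_switched_neg_edges_atMost_iff[OF _ assms(2)] by simp
    next
      case (long i)
      then have "i = q \<or> i = (q + (m - 1)) mod m"
        using e long_in_switched_neg_edges_atMost_iff[OF assms(1) _ assms(2)] pred by blast
      then show ?thesis
        using long(2) by blast
    qed
  qed
  then have "card (switched_neg_edges (cycle_square m) {..q}) \<le>
      card {2 * q, Suc (2 * q), Suc (2 * ((q + (m - 1)) mod m))}"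
    by (intro card_mono) auto
  also have "\<dots> \<le> 3"
    by (simp add: card_insert_if)
  finally show ?thesis .
qed

lemma critically_frustrated_cycle_square:
  assumes "even m" "m > 0"
  shows "critically_frustrated 3 (cycle_square m)"
proof -
  let ?N = "\<lambda>q. switched_neg_edges (cycle_square m) {..q}"
  note G = signed_graph_cycle_square[of m]
  have "m \<ge> 2"
    using assms by (auto elim: evenE)
  have card: "card (?N q) = 3 \<and> frustration_index (cycle_square m) = 3" if "q < m" for q
    using frustration_index_cycle_square_ge[OF assms] frustration_index_le[OF G, of "{..q}"]
      card_switched_neg_edges_cycle_square_le[OF \<open>m \<ge> 2\<close> that] by simp
  have "\<exists>q<m. e \<in> ?N q" if "e \<in> edges (cycle_square m)" for e
    using that short_in_switched_neg_edges_atMost_iff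
      long_in_switched_neg_edges_atMost_iff[OF \<open>m \<ge> 2\<close>]
    by (cases rule: cycle_square_edge_cases) auto
  then show ?thesis
    unfolding critically_frustrated_iff[OF G] using card assms(2) by metis
qed

subsection \<open>Infinitely many irreducible critical graphs\<close>

definition planar_critical :: "nat \<Rightarrow> ('v, 'e) sgraph \<Rightarrow> bool" where
  "planar_critical k G \<longleftrightarrow>
     signed_graph G \<and> no_subdivision_vertex G \<and> critically_frustrated k G \<and> planar G"

lemma planar_critical_imp:
  assumes "planar_critical k G"
  shows "signed_graph G \<and> no_isolated_vertices G \<and> irreducible_sgraph G \<and>
    critically_frustrated k G \<and> planar G"
  using assms no_isolated_vertices_if_no_subdivision_vertex
    irreducible_sgraph_if_no_subdivision_vertex
  unfolding planar_critical_def by blast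

lemma planar_critical_cycle_square:
  assumes "even m" "m \<ge> 4"
  shows "planar_critical 3 (cycle_square m)"
proof -
  have "planar (cycle_square m)"
    using planar_drawing_cycle_square[OF assms(1)] planar_iff_planar_drawing by blast
  then show ?thesis
    using assms signed_graph_cycle_square no_subdivision_vertex_cycle_square
      critically_frustrated_cycle_square by (simp add: planar_critical_def)
qed

lemma planar_critical_add_negative_loop:
  assumes "planar_critical k G" "v \<notin> verts G" "e \<notin> edges G"
  shows "planar_critical (Suc k) (add_negative_loop v e G)"
  unfolding planar_critical_def
  by (intro conjI signed_graph_add_negative_loop no_subdivision_vertex_add_negative_loop
      critically_frustrated_add_negative_loop planar_add_negative_loop)
    (use assms in \<open>simp_all add: planar_critical_def\<close>)

lemma exists_planar_critical:
  assumes "k \<ge> 3" "even m" "m \<ge> 4"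
  shows "\<exists>G :: (nat, nat) sgraph. planar_critical k G \<and> card (verts G) = m + k - 3"
  using assms(1)
proof (induction k rule: dec_induct)
  case base
  show ?case
    using planar_critical_cycle_square[OF assms(2,3)]
    by (intro exI[of _ "cycle_square m"]) simp
next
  case (step k)
  then obtain G :: "(nat, nat) sgraph" where G: "planar_critical k G" "card (verts G) = m + k - 3"
    by blast
  then have finite: "finite (verts G)" "finite (edges G)"
    by (simp_all add: planar_critical_def signed_graph_def)
  obtain v e where v: "v \<notin> verts G" and e: "e \<notin> edges G"
    using finite ex_new_if_finite[OF infinite_UNIV_nat] by metis
  have "card (verts (add_negative_loop v e G)) = m + Suc k - 3"
    using G(2) v finite(1) step.hyps(1) by (simp add: add_negative_loop_def)
  then show ?case
    using planar_critical_add_negative_loop[OF G(1) v e] by blast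
qed

lemma switching_isomorphic_card_verts:
  assumes "switching_isomorphic G H"
  shows "card (verts G) = card (verts H)"
proof -
  obtain G' f where "switching_equiv G G'" "bij_betw f (verts G') (verts H)"
    using assms unfolding switching_isomorphic_def isomorphic_sgraph_def by blast
  then show ?thesis
    using switching_equiv_structure(1) bij_betw_same_card by metis
qed

lemma exists_infinite_family_if_card_verts:
  fixes card_of :: "nat \<Rightarrow> nat"
  assumes "inj card_of" and "\<And>n. \<exists>G. P G \<and> card (verts G) = card_of n"
  shows "\<exists>F. infinite F \<and> (\<forall>G\<in>F. P G) \<and> pairwise (\<lambda>G H. \<not> switching_isomorphic G H) F"
proof -
  obtain f where f: "P (f n)" and card: "card (verts (f n)) = card_of n" for n
    using assms(2) by metis
  have distinct: "i = j" if "card (verts (f i)) = card (verts (f j))" for i j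
    using that injD[OF assms(1)] by (simp add: card)
  then have "infinite (range f)"
    by (intro range_inj_infinite injI) simp
  moreover have "pairwise (\<lambda>G H. \<not> switching_isomorphic G H) (range f)"
  proof (intro pairwiseI notI)
    fix G H
    assume "G \<in> range f" "H \<in> range f" "G \<noteq> H" "switching_isomorphic G H"
    then show False
      using distinct switching_isomorphic_card_verts[of G H] by blast
  qed
  ultimately show ?thesis
    using f by (intro exI[of _ "range f"]) simp
qed

theorem mainTheorem16:
  fixes k :: nat
  assumes "k \<ge> 3"
  shows "\<exists>F :: (nat, nat) sgraph set. infinite F \<and>
           (\<forall>G\<in>F. signed_graph G \<and> no_isolated_vertices G \<and> irreducible_sgraph G \<and>
              critically_frustrated k G \<and> planar G) \<and>
           pairwise (\<lambda>G H. \<not> switching_isomorphic G H) F"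
proof -
  have "inj (\<lambda>n. 2 * n + 6 + k - 3)"
    using assms by (intro injI) simp
  moreover have "\<exists>G :: (nat, nat) sgraph. planar_critical k G \<and> card (verts G) = 2 * n + 6 + k - 3"
    for n
    using exists_planar_critical[OF assms, of "2 * n + 6"] by simp
  ultimately have "\<exists>F :: (nat, nat) sgraph set. infinite F \<and> (\<forall>G\<in>F. planar_critical k G) \<and>
      pairwise (\<lambda>G H. \<not> switching_isomorphic G H) F"
    by (rule exists_infinite_family_if_card_verts)
  then show ?thesis
    using planar_critical_imp[of k] by (elim ex_forward) blast
qed

end
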